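(* For contextuality scenarios with non-trivial equivalences of measurement effects, projective measurements cannot in general produce all quantum contextual behaviours. That is, there exists a contextuality scenario $T=(X,Y,K,\mathcal{OE}_P,\mathcal{OE}_M)$ with $\mathcal{OE}_M\neq\emptyset$ for which $\mathcal{Q}^{\Pi}\subsetneq\mathcal{Q}$.
   Context: For a positive integer $N$, $[N]=\{0,\dots,N-1\}$. A contextuality scenario is a tuple $T=(X,Y,K,\mathcal{OE}_P,\mathcal{OE}_M)$ where $X,Y,K$ are positive integers (numbers of preparations, measurements, and outcomes per measurement), $\mathcal{OE}_P=\{\{\alpha^v_j\}_{j\in[V_v]}\}_{v\in[V]}$ is a finite (possibly empty) family in which each $\{\alpha^v_j\}_{j\in[V_v]}$ consists of $V_v\ge 2$ distinct probability distributions on $[X]$, and $\mathcal{OE}_M=\{\{\beta^w_j\}_{j\in[W_w]}\}_{w\in[W]}$ is a finite (possibly empty) family in which each $\{\beta^w_j\}_{j\in[W_w]}$ consists of $W_w\ge 2$ distinct probability distributions on $[K]\times[Y]$. By convention, equivalences that merely express the completeness of measurements (outcome probabilities of each measurement sum to one) are not listed in $\mathcal{OE}_M$; non-trivial equivalences of measurement effects means $\mathcal{OE}_M\ne\emptyset$. A behaviour is a vector $\mathbf{p}=(p(k|x,y))_{x\in[X],y\in[Y],k\in[K]}\in\mathbb{R}^{XYK}$. $\mathcal{Q}$ is the set of behaviours for which there exist a finite-dimensional complex Hilbert space $\mathcal{H}$ (of arbitrary dimension), density operators $\rho_x$ ($x\in[X]$) on $\mathcal{H}$ and POVMs $\{M^y_k\}_{k\in[K]}$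 ($y\in[Y]$) on $\mathcal{H}$ (i.e. $M^y_k\ge0$, $\sum_kM^y_k=\mathbb{I}$) such that $p(k|x,y)=\operatorname{tr}(\rho_xM^y_k)$ for all $x,y,k$, and: (i) for every $v\in[V]$ the operator $\sum_x\alpha^v_j(x)\rho_x$ is the same for all $j\in[V_v]$; (ii) for every $w\in[W]$ the operator $\sum_{k,y}\beta^w_j(k,y)M^y_k$ is the same for all $j\in[W_w]$. $\mathcal{Q}^{\Pi}\subseteq\mathcal{Q}$ is the set of behaviours admitting such a realisation in which in addition every measurement is projective, i.e. $(M^y_k)^2=M^y_k$ for all $y,k$. *)

theory Defs
  imports
    "HOL-Probability.Probability_Mass_Function"
    "Jordan_Normal_Form.Matrix"
begin

text \<open>
  A finite-dimensional complex Hilbert space is, up to unitary equivalence, \<open>\<complex>\<^sup>n\<close>; operators on it are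
  the elements of \<^term>\<open>carrier_mat n n\<close> over \<^typ>\<open>complex\<close>. The dimension is a bound variable of the
  definitions below, which is why the matrices are not indexed by types. Dimension \<open>n = 0\<close> admits
  no density operator, so it need not be excluded.
\<close>

abbreviation op_sum :: "nat \<Rightarrow> ('i \<Rightarrow> complex mat) \<Rightarrow> 'i set \<Rightarrow> complex mat" where
  "op_sum n \<equiv> finsum (module_mat TYPE(complex) n n)"

definition mat_trace :: "complex mat \<Rightarrow> complex" where
  "mat_trace A = (\<Sum>i<dim_row A. A $$ (i, i))"

text \<open>
  In the order on \<^typ>\<open>complex\<close>, \<open>0 \<le> z\<close> means that \<open>z\<close> is real and nonnegative; over \<open>\<complex>\<close> a matrix
  all of whose quadratic-form values are real is Hermitian.
\<close>
definition psd :: "nat \<Rightarrow> complex mat \<Rightarrow> bool" where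
  "psd n A \<longleftrightarrow> A \<in> carrier_mat n n \<and> (\<forall>v \<in> carrier_vec n. 0 \<le> (A *\<^sub>v v) \<bullet>c v)"

definition density_operator :: "nat \<Rightarrow> complex mat \<Rightarrow> bool" where
  "density_operator n \<rho> \<longleftrightarrow> psd n \<rho> \<and> mat_trace \<rho> = 1"

definition povm :: "nat \<Rightarrow> nat \<Rightarrow> (nat \<Rightarrow> complex mat) \<Rightarrow> bool" where
  "povm n K M \<longleftrightarrow> (\<forall>k<K. psd n (M k)) \<and> op_sum n M {..<K} = 1\<^sub>m n"

definition projective :: "nat \<Rightarrow> (nat \<Rightarrow> complex mat) \<Rightarrow> bool" where
  "projective K M \<longleftrightarrow> (\<forall>k<K. M k * M k = M k)"

definition prep_mixture :: "nat \<Rightarrow> nat \<Rightarrow> (nat \<Rightarrow> complex mat) \<Rightarrow> nat pmf \<Rightarrow> complex mat" where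
  "prep_mixture n X \<rho> \<alpha> = op_sum n (\<lambda>x. complex_of_real (pmf \<alpha> x) \<cdot>\<^sub>m \<rho> x) {..<X}"

text \<open>The effect \<open>M\<^sup>y\<^sub>k\<close> is \<open>M y k\<close>; the distributions \<open>\<beta>\<close> live on pairs \<open>(k, y)\<close>.\<close>
definition effect_mixture ::
    "nat \<Rightarrow> nat \<Rightarrow> nat \<Rightarrow> (nat \<Rightarrow> nat \<Rightarrow> complex mat) \<Rightarrow> (nat \<times> nat) pmf \<Rightarrow> complex mat" where
  "effect_mixture n Y K M \<beta> =
     op_sum n (\<lambda>(k, y). complex_of_real (pmf \<beta> (k, y)) \<cdot>\<^sub>m M y k) ({..<K} \<times> {..<Y})"

definition prep_equivalence_holds ::
    "nat \<Rightarrow> nat \<Rightarrow> (nat \<Rightarrow> complex mat) \<Rightarrow> nat pmf list \<Rightarrow> bool" where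
  "prep_equivalence_holds n X \<rho> \<alpha>s \<longleftrightarrow>
     (\<forall>i<length \<alpha>s. \<forall>j<length \<alpha>s. prep_mixture n X \<rho> (\<alpha>s ! i) = prep_mixture n X \<rho> (\<alpha>s ! j))"

definition effect_equivalence_holds ::
    "nat \<Rightarrow> nat \<Rightarrow> nat \<Rightarrow> (nat \<Rightarrow> nat \<Rightarrow> complex mat) \<Rightarrow> (nat \<times> nat) pmf list \<Rightarrow> bool" where
  "effect_equivalence_holds n Y K M \<beta>s \<longleftrightarrow>
     (\<forall>i<length \<beta>s. \<forall>j<length \<beta>s. effect_mixture n Y K M (\<beta>s ! i) = effect_mixture n Y K M (\<beta>s ! j))"

text \<open>
  An equivalence of effects merely expresses completeness if nothing but \<open>\<Sum>\<^sub>k M\<^sup>y\<^sub>k = \<I>\<close> is needed for it,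
  that is, if every choice of POVMs satisfies it.
\<close>
definition completeness_only :: "nat \<Rightarrow> nat \<Rightarrow> (nat \<times> nat) pmf list \<Rightarrow> bool" where
  "completeness_only Y K \<beta>s \<longleftrightarrow>
     (\<forall>n M. (\<forall>y<Y. povm n K (M y)) \<longrightarrow> effect_equivalence_holds n Y K M \<beta>s)"

record scenario =
  num_preps :: nat
  num_meas :: nat
  num_outcomes :: nat
  OE_P :: "nat pmf list list"
  OE_M :: "(nat \<times> nat) pmf list list"

text \<open>
  The last clause is the convention that equivalences which merely express completeness are not
  listed; with it, non-triviality of the effect equivalences amounts to \<open>OE_M T \<noteq> []\<close>.
\<close>
definition contextuality_scenario :: "scenario \<Rightarrow> bool" where
  "contextuality_scenario T \<longleftrightarrow>
     num_preps T > 0 \<and> num_meas T > 0 \<and> num_outcomes T > 0 \<and>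
     (\<forall>\<alpha>s \<in> set (OE_P T). length \<alpha>s \<ge> 2 \<and> distinct \<alpha>s \<and>
        (\<forall>\<alpha> \<in> set \<alpha>s. set_pmf \<alpha> \<subseteq> {..<num_preps T})) \<and>
     (\<forall>\<beta>s \<in> set (OE_M T). length \<beta>s \<ge> 2 \<and> distinct \<beta>s \<and>
        (\<forall>\<beta> \<in> set \<beta>s. set_pmf \<beta> \<subseteq> {..<num_outcomes T} \<times> {..<num_meas T})) \<and>
     (\<forall>\<beta>s \<in> set (OE_M T). \<not> completeness_only (num_meas T) (num_outcomes T) \<beta>s)"

text \<open>
  The vectors \<open>(p(k|x,y))\<close> in \<open>\<real>\<^bsup>XYK\<^esup>\<close>, as functions of \<open>(k, x, y)\<close> that are \<^term>\<open>undefined\<close> outside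
  the index set.
\<close>
definition behaviours :: "scenario \<Rightarrow> (nat \<times> nat \<times> nat \<Rightarrow> real) set" where
  "behaviours T = ({..<num_outcomes T} \<times> {..<num_preps T} \<times> {..<num_meas T}) \<rightarrow>\<^sub>E UNIV"

definition quantum_realisation ::
    "scenario \<Rightarrow> nat \<Rightarrow> (nat \<Rightarrow> complex mat) \<Rightarrow> (nat \<Rightarrow> nat \<Rightarrow> complex mat) \<Rightarrow>
     (nat \<times> nat \<times> nat \<Rightarrow> real) \<Rightarrow> bool" where
  "quantum_realisation T n \<rho> M p \<longleftrightarrow>
     (\<forall>x<num_preps T. density_operator n (\<rho> x)) \<and>
     (\<forall>y<num_meas T. povm n (num_outcomes T) (M y)) \<and>
     (\<forall>x<num_preps T. \<forall>y<num_meas T. \<forall>k<num_outcomes T.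
        complex_of_real (p (k, x, y)) = mat_trace (\<rho> x * M y k)) \<and>
     (\<forall>\<alpha>s \<in> set (OE_P T). prep_equivalence_holds n (num_preps T) \<rho> \<alpha>s) \<and>
     (\<forall>\<beta>s \<in> set (OE_M T). effect_equivalence_holds n (num_meas T) (num_outcomes T) M \<beta>s)"

definition quantum_set :: "scenario \<Rightarrow> (nat \<times> nat \<times> nat \<Rightarrow> real) set" where
  "quantum_set T = {p \<in> behaviours T. \<exists>n \<rho> M. quantum_realisation T n \<rho> M p}"

definition projective_quantum_set :: "scenario \<Rightarrow> (nat \<times> nat \<times> nat \<Rightarrow> real) set" where
  "projective_quantum_set T =
     {p \<in> behaviours T. \<exists>n \<rho> M. quantum_realisation T n \<rho> M p \<and>
        (\<forall>y<num_meas T. projective (num_outcomes T) (M y))}"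

end

theory Submission
  imports Defs
begin

text \<open>
  A single two-outcome measurement subject to the equivalence \<open>M\<^sub>0 \<simeq> M\<^sub>1\<close> must have \<open>M\<^sub>0 = M\<^sub>1 = \<I>/2\<close>.
  This is a POVM, but it is not projective, so \<open>\<Q>\<^sup>\<Pi>\<close> is empty while \<open>\<Q>\<close> contains the fair coin.
\<close>

lemma op_sum_lessThan_2:
  fixes M :: "nat \<Rightarrow> complex mat"
  assumes "M 0 \<in> carrier_mat n n" "M 1 \<in> carrier_mat n n"
  shows "op_sum n M {..<2} = M 0 + M 1"
proof -
  interpret abelian_group "module_mat TYPE(complex) n n"
    by (rule abelian_group_mat)
  have "{..<2::nat} = {0, 1}" by auto
  then show ?thesis
    using assms by (simp add: finsum_insert finsum_empty module_mat_simps)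
qed

text \<open>A point mass gives weight 1 to one effect and 0 to all others, so the sum collapses.
  Equivalences between single effects can thus be encoded by point masses.\<close>

lemma effect_mixture_return_pmf:
  assumes "\<And>k y. k < K \<Longrightarrow> y < Y \<Longrightarrow> M y k \<in> carrier_mat n n" "k < K" "y < Y"
  shows "effect_mixture n Y K M (return_pmf (k, y)) = M y k"
proof -
  interpret abelian_group "module_mat TYPE(complex) n n"
    by (rule abelian_group_mat)
  let ?f = "\<lambda>(k, y). M y k"
  have closed: "?f \<in> {..<K} \<times> {..<Y} \<rightarrow> carrier_mat n n"
    using assms(1) by auto
  have zero: "0 \<cdot>\<^sub>m A = 0\<^sub>m n n" if "A \<in> carrier_mat n n" for A :: "complex mat"
    using that by (intro eq_matI) auto
  have "effect_mixture n Y K M (return_pmf (k, y)) =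
      op_sum n (\<lambda>z. if (k, y) = z then ?f z else 0\<^sub>m n n) ({..<K} \<times> {..<Y})"
    unfolding effect_mixture_def
    using assms zero
    by (intro finsum_cong') (auto simp: module_mat_simps of_bool_def)
  also have "\<dots> = ?f (k, y)"
    using assms(2,3) closed finsum_singleton[of "(k, y)" "{..<K} \<times> {..<Y}" ?f]
    unfolding module_mat_simps by simp
  finally show ?thesis by simp
qed

lemma psd_smult_one:
  assumes "0 \<le> c"
  shows "psd n (c \<cdot>\<^sub>m 1\<^sub>m n)"
  unfolding psd_def
proof safe
  fix v :: "complex vec"
  assume v: "v \<in> carrier_vec n"
  have "(c \<cdot>\<^sub>m 1\<^sub>m n) *\<^sub>v v = c \<cdot>\<^sub>v v"
    using v by (intro eq_vecI) auto
  then have "((c \<cdot>\<^sub>m 1\<^sub>m n) *\<^sub>v v) \<bullet>c v = c * (v \<bullet>c v)"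
    using v by simp
  with assms v show "0 \<le> ((c \<cdot>\<^sub>m 1\<^sub>m n) *\<^sub>v v) \<bullet>c v"
    using conjugate_square_ge_0_vec[of v] by simp
qed simp

lemma povm_2_iff:
  "povm n 2 M \<longleftrightarrow> psd n (M 0) \<and> psd n (M 1) \<and> M 0 + M 1 = 1\<^sub>m n"
  unfolding povm_def
  using op_sum_lessThan_2[of M n] by (auto simp: less_2_cases_iff psd_def)

text \<open>Pairs are (outcome, measurement), so the two point masses equate the two outcomes. The
  one preparation serves to exclude dimension 0.\<close>

definition fair_coin_scenario :: scenario where
  "fair_coin_scenario = \<lparr>num_preps = 1, num_meas = 1, num_outcomes = 2, OE_P = [],
     OE_M = [[return_pmf (0, 0), return_pmf (1, 0)]]\<rparr>"

lemma fair_coin_equivalence_iff: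
  assumes "povm n 2 (M 0)"
  shows "effect_equivalence_holds n 1 2 M [return_pmf (0, 0), return_pmf (1, 0)] \<longleftrightarrow> M 0 0 = M 0 1"
proof -
  have "effect_mixture n 1 2 M (return_pmf (k, 0)) = M 0 k" if "k < 2" for k
    using assms that by (intro effect_mixture_return_pmf) (auto simp: povm_def psd_def)
  from this[of 0] this[of 1] show ?thesis
    unfolding effect_equivalence_holds_def by (auto simp: less_Suc_eq)
qed

text \<open>Multiplying \<open>M 0 + M 0 = 1\<^sub>m n\<close> by the idempotent \<open>M 0\<close>
  gives \<open>M 0 + M 0 = M 0\<close>, so the identity would be zero, which is possible only in
  dimension 0.\<close>

lemma projective_eq_dim_0:
  assumes "povm n 2 M" "projective 2 M" "M 0 = M 1"
  shows "n = 0"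
proof (rule ccontr)
  assume n: "n \<noteq> 0"
  have A: "M 0 \<in> carrier_mat n n" "M 0 + M 0 = 1\<^sub>m n" "M 0 * M 0 = M 0"
    using assms by (auto simp: povm_2_iff projective_def psd_def)
  have "M 0 + M 0 = (M 0 + M 0) * M 0"
    using A(1) by (simp add: add_mult_distrib_mat A(3))
  also have "\<dots> = M 0"
    unfolding A(2) using A(1) by simp
  \<comment> \<open>For n > 0 the entry (0, 0) exists; it would have to be both 0 and 1/2.\<close>
  finally have "M 0 $$ (0, 0) + M 0 $$ (0, 0) = M 0 $$ (0, 0)"
    using A(1) n by (metis carrier_matD index_add_mat(1) not_gr_zero)
  moreover have "M 0 $$ (0, 0) + M 0 $$ (0, 0) = 1"
    using arg_cong[OF A(2), of "\<lambda>B. B $$ (0, 0)"] A(1) n by simp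
  ultimately show False
    by simp
qed

lemma contextuality_scenario_fair_coin: "contextuality_scenario fair_coin_scenario"
proof -
  \<comment> \<open>The deterministic measurement with effects 1 and 0 in dimension 1 is a POVM
    violating the equivalence, which therefore says more than completeness.\<close>
  define M :: "nat \<Rightarrow> nat \<Rightarrow> complex mat"
    where "M = (\<lambda>y k. (if k = 0 then 1 else 0) \<cdot>\<^sub>m 1\<^sub>m 1)"
  have povm: "povm 1 2 (M 0)"
    by (auto simp: povm_2_iff M_def intro!: psd_smult_one simp: less_eq_complex_def)
  have "M 0 0 $$ (0, 0) \<noteq> M 0 1 $$ (0, 0)"
    by (simp add: M_def)
  then have "\<not> completeness_only 1 2 [return_pmf (0, 0), return_pmf (1, 0)]"
    using povm fair_coin_equivalence_iff[of 1 M] unfolding completeness_only_def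
    by (metis less_one)
  then show ?thesis
    by (simp add: contextuality_scenario_def fair_coin_scenario_def)
qed

lemma projective_quantum_set_fair_coin: "projective_quantum_set fair_coin_scenario = {}"
proof -
  have False if "quantum_realisation fair_coin_scenario n \<rho> M p" "projective 2 (M 0)" for n \<rho> M p
  proof -
    have "povm n 2 (M 0)" "M 0 0 = M 0 1" "density_operator n (\<rho> 0)"
      using that(1) fair_coin_equivalence_iff[of n M]
      by (auto simp: quantum_realisation_def fair_coin_scenario_def)
    \<comment> \<open>In dimension 0 the trace is an empty sum, hence 0 and not 1, so no density
      operator exists.\<close>
    with that(2) projective_eq_dim_0[of n "M 0"] show False
      by (auto simp: density_operator_def mat_trace_def psd_def)
  qed
  then show ?thesis
    by (fastforce simp: projective_quantum_set_def fair_coin_scenario_def)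
qed

lemma quantum_set_fair_coin: "quantum_set fair_coin_scenario \<noteq> {}"
proof -
  \<comment> \<open>The fair coin; \<open>restrict\<close> makes it \<open>undefined\<close> off the
    index set, as \<open>behaviours\<close> demands.\<close>
  define p :: "nat \<times> nat \<times> nat \<Rightarrow> real"
    where "p = restrict (\<lambda>_. 1/2) ({..<2} \<times> {..<1} \<times> {..<1})"
  \<comment> \<open>Half the identity is forced by the equivalence; dimension 1 is enough, with the
    identity as state.\<close>
  define M :: "nat \<Rightarrow> nat \<Rightarrow> complex mat" where "M = (\<lambda>y k. (1/2) \<cdot>\<^sub>m 1\<^sub>m 1)"
  have povm: "povm 1 2 (M 0)"
    by (auto simp: povm_2_iff M_def intro!: psd_smult_one simp: less_eq_complex_def)
  have "effect_equivalence_holds 1 1 2 M [return_pmf (0, 0), return_pmf (1, 0)]"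
    using povm fair_coin_equivalence_iff[of 1 M] by (simp add: M_def)
  \<comment> \<open>Brings the state into the form covered by \<open>psd_smult_one\<close>.\<close>
  moreover have "1 \<cdot>\<^sub>m 1\<^sub>m 1 = (1\<^sub>m 1 :: complex mat)"
    by (intro eq_matI) auto
  then have "density_operator 1 (1\<^sub>m 1)"
    using psd_smult_one[of 1 1] by (simp add: less_eq_complex_def density_operator_def mat_trace_def)
  moreover have "mat_trace (1\<^sub>m 1 * M 0 k) = 1/2" for k
    by (simp add: M_def mat_trace_def)
  ultimately have "quantum_realisation fair_coin_scenario 1 (\<lambda>_. 1\<^sub>m 1) M p"
    using povm by (simp add: quantum_realisation_def fair_coin_scenario_def p_def)
  moreover have "p \<in> behaviours fair_coin_scenario"
    by (simp add: behaviours_def fair_coin_scenario_def p_def)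
  ultimately show ?thesis
    by (auto simp: quantum_set_def)
qed

theorem mainTheorem7:
  shows "\<exists>T. contextuality_scenario T \<and> OE_M T \<noteq> [] \<and>
           projective_quantum_set T \<subset> quantum_set T"
proof (intro exI conjI)
  show "OE_M fair_coin_scenario \<noteq> []"
    by (simp add: fair_coin_scenario_def)
  \<comment> \<open>The inclusion is strict because the left side is empty and the right side is
    not.\<close>
  show "projective_quantum_set fair_coin_scenario \<subset> quantum_set fair_coin_scenario"
    using projective_quantum_set_fair_coin quantum_set_fair_coin by blast
qed (rule contextuality_scenario_fair_coin)

end
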